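(* Let $X$ be a nonnegative absolutely continuous random variable with support $(0,s)$, $0<s\le\infty$, CDF $K$ and PDF $k$, let $\psi\ge0$ be a weight function and $\gamma>0$. Put $$h(x)=\ln K(x),\qquad f(x)=\frac{\psi(x)(K(x))^2}{k(x)},\qquad 0<x<s,$$ and assume that $h$ is strictly increasing with continuous derivative on $(0,s)$ and that $f$ is well defined and continuous on $(0,s)$. Then $$\lim_{a\to0^+,\ t\to s^-}J_{a^+;h}^{\gamma+1}f(t)=CPE_\gamma^\psi(X).$$
   Context: The weighted fractional generalized cumulative past entropy (WFGCPE) of order $\gamma>0$ of $X$ with weight $\psi$ is $$CPE_\gamma^\psi(X)=\frac{1}{\Gamma(\gamma+1)}\int_0^s\psi(x)K(x)[-\ln K(x)]^\gamma\,dx,$$ assumed finite, where $\Gamma$ is the gamma function. For $\delta>0$, a strictly increasing function $h$ with continuous first derivative $h'$, and a real-valued continuous function $f$, the left-sided Riemann–Liouville fractional integral of order $\delta$ of $f$ with respect to $h$ is $$J_{a^+;h}^{\delta}f(t)=\frac{1}{\Gamma(\delta)}\int_a^t\frac{h'(\tau)f(\tau)}{(h(t)-h(\tau))^{1-\delta}}\,d\tau ,\qquad t>a .$$ Here $0<a<t<s$. *)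

theory Defs
  imports "HOL-Probability.Probability"
begin

definition RL_integral ::
  "real \<Rightarrow> (real \<Rightarrow> real) \<Rightarrow> (real \<Rightarrow> real) \<Rightarrow> real \<Rightarrow> real \<Rightarrow> real" where
  "RL_integral \<delta> h f a t =
     1 / Gamma \<delta> * (LBINT \<tau>=a..t. deriv h \<tau> * f \<tau> / (h t - h \<tau>) powr (1 - \<delta>))"

definition CPE_integrand :: "(real \<Rightarrow> real) \<Rightarrow> real \<Rightarrow> (real \<Rightarrow> real) \<Rightarrow> real \<Rightarrow> real" where
  "CPE_integrand \<psi> \<gamma> K x = \<psi> x * K x * (- ln (K x)) powr \<gamma>"

text \<open>The upper end \<open>s\<close> of the support is a parameter; it may be infinite.  Finiteness of the
  entropy is the separate predicate below, because a divergent Bochner integral has value 0.\<close>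

definition CPE ::
  "'a measure \<Rightarrow> ('a \<Rightarrow> real) \<Rightarrow> ereal \<Rightarrow> (real \<Rightarrow> real) \<Rightarrow> real \<Rightarrow> real" where
  "CPE M X s \<psi> \<gamma> =
     1 / Gamma (\<gamma> + 1) * (LBINT x=0..s. CPE_integrand \<psi> \<gamma> (cdf (distr M borel X)) x)"

definition CPE_finite ::
  "'a measure \<Rightarrow> ('a \<Rightarrow> real) \<Rightarrow> ereal \<Rightarrow> (real \<Rightarrow> real) \<Rightarrow> real \<Rightarrow> bool" where
  "CPE_finite M X s \<psi> \<gamma> \<longleftrightarrow>
     interval_lebesgue_integrable lborel 0 s (CPE_integrand \<psi> \<gamma> (cdf (distr M borel X)))"

end

theory Submission
  imports Defs
begin

text \<open>
  Write \<open>E = (0, s)\<close>.  Since \<open>K = exp h\<close> on \<open>E\<close>, the distribution function is continuously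
  differentiable there, so its derivative \<open>K h'\<close> is a second density of the law of \<open>X\<close>; hence
  \<open>k = K h'\<close> almost everywhere on \<open>E\<close> (\<open>density_eq_deriv_cdf_AE\<close>).  At every such point
  \<open>h' f = (k / K) (\<psi> K\<^sup>2 / k) = \<psi> K\<close>.  With \<open>c = h' f\<close>, which is continuous, the fractional
  integral of order \<open>\<gamma> + 1\<close> is therefore, up to the factor \<open>1 / \<Gamma>(\<gamma> + 1)\<close>,
  the integral of \<open>c(x) (h(t) - h(x))\<^sup>\<gamma>\<close> over \<open>(a, t)\<close>, while the entropy is that of
  \<open>c(x) (- h(x))\<^sup>\<gamma>\<close> over \<open>E\<close>.

  The law has no mass at or beyond \<open>s\<close>, so \<open>K(t)\<close> tends to \<open>1\<close> and \<open>h(t)\<close> to \<open>0\<close> as \<open>t\<close> tends to \<open>s\<close>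
  (\<open>cdf_tendsto_1_at_left_sup\<close>).  Because \<open>h\<close> is increasing and nonpositive, the truncated
  integrands grow towards the entropy integrand, which dominates them, as \<open>a\<close> decreases and \<open>t\<close>
  increases; finiteness of
  the entropy then gives convergence of the integrals (\<open>truncated_kernel_tendsto\<close>).
\<close>

section \<open>Densities as derivatives of distribution functions\<close>

text \<open>
  By the fundamental theorem of calculus the restrictions of both densities to \<open>(l, u]\<close> give the
  same mass to every half-line.  A finite measure is determined by these masses and, up to null
  sets, determines its density.
\<close>


lemma density_eq_deriv_cdf_AE:
  fixes k D :: "real \<Rightarrow> real"
  assumes N: "finite_borel_measure N" and dens: "N = density lborel (\<lambda>x. ennreal (k x))"
    and k[measurable]: "k \<in> borel_measurable borel" and k0: "\<And>x. 0 \<le> k x"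
    and "l \<le> u" and D: "continuous_on {l..u} D" "\<And>x. x \<in> {l..u} \<Longrightarrow> 0 \<le> D x"
    and deriv: "\<And>x. x \<in> {l..u} \<Longrightarrow> (cdf N has_real_derivative D x) (at x)"
  shows "AE x in lborel. x \<in> {l<..u} \<longrightarrow> k x = D x"
proof -
  interpret N: finite_borel_measure N by (rule N)
  define D' where "D' x = indicator {l..u} x * D x" for x
  have D'[measurable]: "D' \<in> borel_measurable borel"
    using borel_measurable_continuous_on_indicator[OF _ D(1)] by (simp add: D'_def[abs_def])
  define g1 g2 where "g1 x = ennreal (k x * indicator {l<..u} x)"
    and "g2 x = ennreal (D' x * indicator {l<..u} x)" for x
  have [measurable]: "g1 \<in> borel_measurable lborel" "g2 \<in> borel_measurable lborel"
    unfolding g1_def g2_def by measurable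
  have mass: "emeasure (density lborel g1) {..x} = ennreal (cdf N (max l (min x u)) - cdf N l)
      \<and> emeasure (density lborel g2) {..x} = ennreal (cdf N (max l (min x u)) - cdf N l)" for x
  proof -
    \<comment> \<open>Clamping \<open>x\<close> to \<open>[l, u]\<close> covers the half-lines ending left of \<open>l\<close> or right of \<open>u\<close>.\<close>
    define m where "m = max l (min x u)"
    have lm: "l \<le> m" "m \<le> u" using \<open>l \<le> u\<close> by (auto simp: m_def)
    have cap: "{l<..u} \<inter> {..x} = {l<..m}" using \<open>l \<le> u\<close> by (auto simp: m_def)
    have "emeasure (density lborel g1) {..x} = (\<integral>\<^sup>+y. ennreal (k y) * indicator {l<..m} y \<partial>lborel)"
      unfolding cap[symmetric]
      by (auto simp: emeasure_density g1_def indicator_def intro!: nn_integral_cong)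
    also have "\<dots> = emeasure N {l<..m}"
      unfolding dens by (simp add: emeasure_density)
    also have "\<dots> = ennreal (cdf N m - cdf N l)"
      using N.emeasure_Ioc[OF lm(1)] by simp
    finally have 1: "emeasure (density lborel g1) {..x} = ennreal (cdf N m - cdf N l)" .
    have "emeasure (density lborel g2) {..x} = (\<integral>\<^sup>+y. ennreal (D' y) * indicator {l<..m} y \<partial>lborel)"
      unfolding cap[symmetric]
      by (auto simp: emeasure_density g2_def indicator_def intro!: nn_integral_cong)
    also have "\<dots> = (\<integral>\<^sup>+y. ennreal (D' y) * indicator {l..m} y \<partial>lborel)"
      by (intro nn_integral_cong_AE eventually_mono[OF AE_lborel_singleton[of l]])
        (auto simp: indicator_def)
    also have "\<dots> = ennreal (cdf N m - cdf N l)"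
      using lm D by (intro nn_integral_FTC_Icc D') (auto simp: D'_def intro: deriv)
    finally show ?thesis using 1 by (simp add: m_def)
  qed
  have fin: "finite_borel_measure (density lborel g)"
    if "\<And>x. emeasure (density lborel g) {..x} = ennreal (cdf N (max l (min x u)) - cdf N l)"
      "\<And>x. x > u \<Longrightarrow> g x = 0" "g \<in> borel_measurable lborel" for g
  proof (intro finite_borel_measure.intro finite_measureI finite_borel_measure_axioms.intro)
    have "emeasure (density lborel g) (space (density lborel g)) = emeasure (density lborel g) {..u}"
      using that(2,3) by (auto simp: emeasure_density indicator_def intro!: nn_integral_cong)
    then show "emeasure (density lborel g) (space (density lborel g)) \<noteq> \<infinity>"
      by (simp only: that(1)) simp
  qed auto
  have "density lborel g1 = density lborel g2"
  proof (rule cdf_unique')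
    show "finite_borel_measure (density lborel g1)" "finite_borel_measure (density lborel g2)"
      by (rule fin; use mass in \<open>auto simp: g1_def g2_def\<close>)+
    show "cdf (density lborel g1) = cdf (density lborel g2)"
      using mass by (auto simp: cdf_def measure_def)
  qed
  then have "AE x in lborel. g1 x = g2 x"
    by (intro sigma_finite_measure.density_unique[OF sigma_finite_lborel]) auto
  then show ?thesis
    by eventually_elim (use D k0 in \<open>auto simp: g1_def g2_def D'_def\<close>)
qed

section \<open>Exhausting the fractional kernel\<close>

text \<open>
  The integral over \<open>(a, t)\<close> increases as \<open>a\<close> decreases and \<open>t\<close> increases, and never exceeds the
  limit.  It therefore suffices to prove convergence along one sequence \<open>(l\<^sub>n, u\<^sub>n)\<close>, where dominated
  convergence applies; monotonicity extends it to the two-parameter limit.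
\<close>
lemma truncated_kernel_tendsto:
  fixes c h :: "real \<Rightarrow> real" and s :: ereal and \<gamma> :: real
  defines "E \<equiv> einterval 0 s"
  assumes "0 < s" "0 < \<gamma>"
    and c: "continuous_on E c" "\<And>x. x \<in> E \<Longrightarrow> 0 \<le> c x"
    and h: "continuous_on E h" "mono_on E h" "\<And>x. x \<in> E \<Longrightarrow> h x \<le> 0"
    and lim: "((\<lambda>t. h (real_of_ereal t)) \<longlongrightarrow> 0) (at_left s)"
    and int: "set_integrable lborel E (\<lambda>x. c x * (- h x) powr \<gamma>)"
  shows "((\<lambda>(a, t). LBINT x=ereal a..ereal (real_of_ereal t). c x * (h (real_of_ereal t) - h x) powr \<gamma>)
      \<longlongrightarrow> (LBINT x:E. c x * (- h x) powr \<gamma>)) (at_right 0 \<times>\<^sub>F at_left s)"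
proof -
  define \<phi> where "\<phi> a t x = indicator {a<..<t} x * (c x * (h t - h x) powr \<gamma>)" for a t x :: real
  define \<phi>' where "\<phi>' x = indicator E x * (c x * (- h x) powr \<gamma>)" for x
  define G where "G a t = integral\<^sup>L lborel (\<phi> a t)" for a t
  have sub: "{a<..<t} \<subseteq> E" if "0 < a" "t \<in> E" for a t
  proof
    fix x assume x: "x \<in> {a<..<t}"
    then have "ereal x < ereal t" by simp
    also have "ereal t < s" using that by (simp add: E_def einterval_iff)
    finally show "x \<in> E" using that x by (simp add: E_def einterval_iff)
  qed
  have hmono: "h x \<le> h y" if "x \<in> E" "y \<in> E" "x \<le> y" for x y
    using h(2) that by (auto simp: mono_on_def)
  have int': "integrable lborel \<phi>'"
    using int by (simp add: set_integrable_def \<phi>'_def[abs_def])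
  have meas: "\<phi> a t \<in> borel_measurable lborel" if "0 < a" "t \<in> E" for a t
  proof -
    have "continuous_on {a<..<t} (\<lambda>x. c x * (h t - h x) powr \<gamma>)"
      using sub[OF that] hmono that \<open>0 < \<gamma>\<close>
      by (intro continuous_intros continuous_on_powr' continuous_on_subset[OF c(1)]
          continuous_on_subset[OF h(1)]) auto
    from borel_measurable_continuous_on_indicator[OF _ this] show ?thesis
      by (simp add: \<phi>_def[abs_def])
  qed
  have le: "\<phi> a t x \<le> \<phi> a' t' x" "0 \<le> \<phi> a t x" "\<phi> a t x \<le> \<phi>' x"
    if "0 < a'" "a' \<le> a" "t \<le> t'" "t \<in> E" "t' \<in> E" for a t a' t' x
  proof -
    show "0 \<le> \<phi> a t x"
      using sub[of a t] that c by (auto simp: \<phi>_def indicator_def)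
    have *: "x \<in> E" "0 \<le> c x" "h x \<le> h t" "h t \<le> h t'" "h t \<le> 0" if "x \<in> {a<..<t}"
      using sub[of a t] that \<open>0 < a'\<close> \<open>a' \<le> a\<close> \<open>t \<in> E\<close> \<open>t' \<in> E\<close> \<open>t \<le> t'\<close> c h(3) hmono by auto
    show "\<phi> a t x \<le> \<phi> a' t' x"
    proof (cases "x \<in> {a<..<t}")
      case True
      with * that \<open>0 < \<gamma>\<close> show ?thesis
        by (auto simp: \<phi>_def intro!: mult_left_mono powr_mono2)
    next
      case False
      then have "\<phi> a t x = 0" by (auto simp: \<phi>_def)
      moreover have "0 \<le> \<phi> a' t' x"
        using sub[of a' t'] that c by (auto simp: \<phi>_def indicator_def)
      ultimately show ?thesis by simp
    qed
    show "\<phi> a t x \<le> \<phi>' x"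
    proof (cases "x \<in> {a<..<t}")
      case True
      with * that \<open>0 < \<gamma>\<close> show ?thesis
        by (auto simp: \<phi>_def \<phi>'_def intro!: mult_left_mono powr_mono2)
    next
      case False
      then have "\<phi> a t x = 0" by (auto simp: \<phi>_def)
      then show ?thesis using c by (auto simp: \<phi>'_def indicator_def)
    qed
  qed
  have integ: "integrable lborel (\<phi> a t)" if "0 < a" "t \<in> E" for a t
  proof (rule Bochner_Integration.integrable_bound[OF int' meas[OF that]], rule AE_I2)
    show "norm (\<phi> a t x) \<le> norm (\<phi>' x)" for x
      using le(2,3)[of a a t t x] that by simp
  qed
  have Gmono: "G a t \<le> G a' t'" if "0 < a'" "a' \<le> a" "t \<le> t'" "t \<in> E" "t' \<in> E" for a t a' t'
    unfolding G_def using that by (intro integral_mono integ le) auto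
  have Gle: "G a t \<le> integral\<^sup>L lborel \<phi>'" if "0 < a" "t \<in> E" for a t
    unfolding G_def using that by (intro integral_mono integ int' le(3)) auto
  obtain u l :: "nat \<Rightarrow> real" where ul: "E = (\<Union>i. {l i..u i})" "incseq u" "decseq l"
      "\<And>i. l i < u i" "\<And>i. 0 < ereal (l i)" "\<And>i. u i < s" "(\<lambda>i. ereal (l i)) \<longlonglongrightarrow> 0" "(\<lambda>i. ereal (u i)) \<longlonglongrightarrow> s"
    unfolding E_def by (blast intro: einterval_Icc_approximation[OF assms(2)])
  have l0: "0 < l i" for i using ul(5)[of i] by simp
  have l_lim: "l \<longlonglongrightarrow> 0" using ul(7) by (simp add: zero_ereal_def)
  have uE: "u i \<in> E" for i
    using ul(4)[of i] unfolding ul(1) by (auto intro: less_imp_le)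
  have hu: "(\<lambda>i. h (u i)) \<longlonglongrightarrow> 0"
  proof -
    have "filterlim (\<lambda>i. ereal (u i)) (at_left s) sequentially"
      using ul(6,8) by (auto simp: filterlim_at intro!: always_eventually less_imp_neq)
    from filterlim_compose[OF lim this] show ?thesis by simp
  qed
  have Glim: "(\<lambda>i. G (l i) (u i)) \<longlonglongrightarrow> integral\<^sup>L lborel \<phi>'"
    unfolding G_def
  proof (rule integral_dominated_convergence[where w = \<phi>'])
    show "AE x in lborel. (\<lambda>i. \<phi> (l i) (u i) x) \<longlonglongrightarrow> \<phi>' x"
    proof (rule AE_I2)
      fix x
      show "(\<lambda>i. \<phi> (l i) (u i) x) \<longlonglongrightarrow> \<phi>' x"
      proof (cases "x \<in> E")
        case True
        then have x: "0 < x" "ereal x < s" by (auto simp: E_def einterval_iff)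
        have "eventually (\<lambda>i. l i < x) sequentially"
          using order_tendstoD(2)[OF l_lim x(1)] .
        moreover have "eventually (\<lambda>i. x < u i) sequentially"
          using order_tendstoD(1)[OF ul(8) x(2)] by simp
        ultimately have ev: "eventually (\<lambda>i. x \<in> {l i<..<u i}) sequentially"
          by eventually_elim simp
        have "(\<lambda>i. c x * (h (u i) - h x) powr \<gamma>) \<longlonglongrightarrow> c x * (0 - h x) powr \<gamma>"
        proof (intro tendsto_intros tendsto_powr' hu)
          show "0 - h x \<noteq> 0 \<or> 0 < \<gamma> \<and> (\<forall>\<^sub>F i in sequentially. 0 \<le> h (u i) - h x)"
            using \<open>0 < \<gamma>\<close> hmono[OF True uE]
            by (intro disjI2 conjI eventually_mono[OF ev]) (auto intro: less_imp_le)
        qed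
        then have "(\<lambda>i. c x * (h (u i) - h x) powr \<gamma>) \<longlonglongrightarrow> \<phi>' x"
          using True by (simp add: \<phi>'_def)
        then show ?thesis
          by (rule Lim_transform_eventually) (use ev in eventually_elim, simp add: \<phi>_def)
      next
        case False
        then have "x \<notin> {l i<..<u i}" for i using sub[OF l0 uE] by blast
        then have "\<phi> (l i) (u i) x = 0" for i by (simp add: \<phi>_def)
        then show ?thesis using False by (simp add: \<phi>'_def)
      qed
    qed
    show "AE x in lborel. norm (\<phi> (l i) (u i) x) \<le> \<phi>' x" for i
      using le(2,3)[OF l0 order_refl order_refl uE uE] by simp
  qed (use int' meas l0 uE in auto)
  have ev: "\<forall>\<^sub>F (a, t) in at_right 0 \<times>\<^sub>F at_left s.
      0 < a \<and> a \<le> l n \<and> t < s \<and> ereal (u n) < t" for n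
  proof -
    have 1: "\<forall>\<^sub>F a in at_right 0. 0 < a \<and> a \<le> l n"
      using eventually_at_right_less[of "0::real"] eventually_at_right_real[OF l0, of n]
      by eventually_elim auto
    have 2: "\<forall>\<^sub>F t in at_left s. ereal (u n) < t \<and> t < s"
      using eventually_at_left[of "ereal (u n)" s] ul(6)[of n] by auto
    from eventually_prodI[OF 1 2] show ?thesis by (auto elim: eventually_mono)
  qed
  have step: "real_of_ereal t \<in> E \<and> u n \<le> real_of_ereal t \<and>
      (LBINT x=ereal a..ereal (real_of_ereal t). c x * (h (real_of_ereal t) - h x) powr \<gamma>)
        = G a (real_of_ereal t)"
    if at: "0 < a" "a \<le> l n" "t < s" "ereal (u n) < t" for a t n
  proof -
    obtain r where t: "t = ereal r" using at by (cases t) auto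
    have "0 < u n" using ul(4)[of n] l0[of n] by simp
    moreover have "a \<le> r" using that ul(4)[of n] by (simp add: t)
    ultimately show ?thesis using that
      by (simp add: t E_def einterval_iff interval_lebesgue_integral_def
          set_lebesgue_integral_def G_def \<phi>_def[abs_def])
  qed
  have target: "(LBINT x:E. c x * (- h x) powr \<gamma>) = integral\<^sup>L lborel \<phi>'"
    by (simp add: set_lebesgue_integral_def \<phi>'_def[abs_def])
  show ?thesis
    unfolding target
  proof (rule order_tendstoI)
    fix y assume "y < integral\<^sup>L lborel \<phi>'"
    from eventually_happens'[OF _ order_tendstoD(1)[OF Glim this]]
    obtain n where n: "y < G (l n) (u n)" by auto
    show "\<forall>\<^sub>F p in at_right 0 \<times>\<^sub>F at_left s. y < (case p of (a, t) \<Rightarrow>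
        LBINT x=ereal a..ereal (real_of_ereal t). c x * (h (real_of_ereal t) - h x) powr \<gamma>)"
      using ev[of n]
    proof (rule eventually_mono, clarify)
      fix a t assume *: "0 < a" "a \<le> l n" "t < s" "ereal (u n) < t"
      note n
      also have "G (l n) (u n) \<le> G a (real_of_ereal t)"
        using step[OF *] * uE by (intro Gmono) auto
      finally show "y < (LBINT x=ereal a..ereal (real_of_ereal t).
          c x * (h (real_of_ereal t) - h x) powr \<gamma>)"
        using step[OF *] by simp
    qed
  next
    fix y assume y: "integral\<^sup>L lborel \<phi>' < y"
    show "\<forall>\<^sub>F p in at_right 0 \<times>\<^sub>F at_left s. (case p of (a, t) \<Rightarrow>
        LBINT x=ereal a..ereal (real_of_ereal t). c x * (h (real_of_ereal t) - h x) powr \<gamma>) < y"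
      using ev[of 0]
    proof (rule eventually_mono, clarify)
      fix a t assume *: "0 < a" "a \<le> l 0" "t < s" "ereal (u 0) < t"
      have "G a (real_of_ereal t) < y"
        using Gle[of a "real_of_ereal t"] step[OF *] * y by auto
      then show "(LBINT x=ereal a..ereal (real_of_ereal t).
          c x * (h (real_of_ereal t) - h x) powr \<gamma>) < y"
        using step[OF *] by simp
    qed
  qed
qed

section \<open>The entropy as a limit of fractional integrals\<close>

text \<open>
  Along any increasing sequence \<open>t \<rightarrow> s\<close> with \<open>t < s\<close> the half-lines up to \<open>t\<close> exhaust the part of the line strictly
  below \<open>s\<close>, which already carries the whole mass.
\<close>
lemma cdf_tendsto_1_at_left_sup:
  fixes s :: ereal
  assumes N: "real_distribution N" and supp: "AE x in N. ereal x < s" and "b < s"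
  shows "((\<lambda>t. cdf N (real_of_ereal t)) \<longlongrightarrow> 1) (at_left s)"
proof (rule tendsto_at_left_sequentially[OF \<open>b < s\<close>])
  interpret N: real_distribution N by (rule N)
  fix S :: "nat \<Rightarrow> ereal"
  assume S: "\<And>n. S n < s" "\<And>n. b < S n" "incseq S" "S \<longlonglongrightarrow> s"
  have real: "S n = ereal (real_of_ereal (S n))" for n
    using S(1,2)[of n] by (cases "S n") auto
  have "(\<lambda>n. measure N {..real_of_ereal (S n)}) \<longlonglongrightarrow> measure N (\<Union>n. {..real_of_ereal (S n)})"
  proof (rule N.finite_Lim_measure_incseq)
    show "incseq (\<lambda>n. {..real_of_ereal (S n)})"
      using S(3) by (auto simp: incseq_def) (metis real ereal_less_eq(3) order_trans)
  qed auto
  also have "measure N (\<Union>n. {..real_of_ereal (S n)}) = 1"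
  proof -
    have "AE x in N. x \<in> (\<Union>n. {..real_of_ereal (S n)})"
      using supp
    proof eventually_elim
      fix x assume "ereal x < s"
      from eventually_happens'[OF _ order_tendstoD(1)[OF S(4) this]]
      obtain n where "ereal x < S n" by auto
      then have "x \<le> real_of_ereal (S n)" by (subst (asm) real) simp
      then show "x \<in> (\<Union>n. {..real_of_ereal (S n)})" by auto
    qed
    then show ?thesis by (subst N.prob_eq_1) auto
  qed
  finally show "(\<lambda>n. cdf N (real_of_ereal (S n))) \<longlonglongrightarrow> 1" by (simp add: cdf_def)
qed

theorem mainTheorem2:
  fixes M :: "'a measure" and X :: "'a \<Rightarrow> real" and s :: ereal
    and K k h f \<psi> :: "real \<Rightarrow> real" and \<gamma> :: real
  assumes "prob_space M"
    and "0 < s"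
    and "AE \<omega> in M. 0 \<le> X \<omega>"
    and "distributed M lborel X (\<lambda>x. ennreal (k x))"
    and "\<And>x. 0 \<le> k x"
    and "{x. 0 < k x} = einterval 0 s"
    and "K = cdf (distr M borel X)"
    and "\<And>x. x \<in> einterval 0 s \<Longrightarrow> 0 \<le> \<psi> x"
    and "0 < \<gamma>"
    and "CPE_finite M X s \<psi> \<gamma>"
    and "\<And>x. x \<in> einterval 0 s \<Longrightarrow> h x = ln (K x)"
    and "\<And>x. x \<in> einterval 0 s \<Longrightarrow> f x = \<psi> x * (K x)\<^sup>2 / k x"
    and "strict_mono_on (einterval 0 s) h"
    and "\<And>x. x \<in> einterval 0 s \<Longrightarrow> h differentiable (at x)"
    and "continuous_on (einterval 0 s) (deriv h)"
    and "continuous_on (einterval 0 s) f"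
  shows "((\<lambda>(a, t). RL_integral (\<gamma> + 1) h f a (real_of_ereal t)) \<longlongrightarrow> CPE M X s \<psi> \<gamma>)
           (at_right 0 \<times>\<^sub>F at_left s)"
proof -
  let ?E = "einterval 0 s"
  define N where "N = distr M borel X"
  have K: "K = cdf N" using assms(7) by (simp add: N_def)
  have k: "k \<in> borel_measurable borel"
    using distributed_real_measurable[OF _ assms(4)] assms(5) by simp
  have dens: "N = density lborel (\<lambda>x. ennreal (k x))"
    using distributed_distr_eq_density[OF assms(4)]
    by (simp add: N_def cong: distr_cong)
  have "X \<in> borel_measurable M" using distributed_measurable[OF assms(4)] by simp
  then have N: "real_distribution N"
    unfolding N_def by (intro prob_space.real_distribution_distr assms(1))
  interpret N: real_distribution N by (rule N)
  have open_E: "open ?E" by simp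
  have hmono: "h x < h y" if "x \<in> ?E" "y \<in> ?E" "x < y" for x y
    using assms(13) that by (auto simp: strict_mono_on_def)
  have below: "\<exists>y\<in>?E. y < x" if "x \<in> ?E" for x
  proof -
    have "ereal (x/2) < ereal x" using that by (auto simp: einterval_iff zero_ereal_def)
    also have "ereal x < s" using that by (auto simp: einterval_iff)
    finally show ?thesis
      using that by (intro bexI[of _ "x/2"]) (auto simp: einterval_iff zero_ereal_def)
  qed
  \<comment> \<open>As \<open>ln 0 = 0\<close>, a zero of \<open>K\<close> would make \<open>h\<close> vanish at every point of \<open>E\<close> to its left,
    and at the zero itself, contradicting strict monotonicity.\<close>
  have Kpos: "0 < K x" if x: "x \<in> ?E" for x
  proof (rule ccontr)
    obtain y where y: "y \<in> ?E" "y < x" using below[OF x] by auto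
    assume "\<not> 0 < K x"
    then have "K x = 0" "K y = 0"
      using N.cdf_nonneg[of x] N.cdf_nonneg[of y] N.cdf_nondecreasing[of y x] y
      by (auto simp: K)
    then have "h x = h y" using assms(11) x y by simp
    with hmono[OF y(1) x y(2)] show False by simp
  qed
  have hle: "h x \<le> 0" if "x \<in> ?E" for x
    using Kpos[OF that] N.cdf_bounded_prob[of x] assms(11)[OF that] by (simp add: K)
  have hmono_on: "mono_on ?E h"
    using assms(13) by (rule strict_mono_on_imp_mono_on)
  have dh: "(h has_real_derivative deriv h x) (at x)" if "x \<in> ?E" for x
    using assms(14)[OF that] DERIV_deriv_iff_real_differentiable by blast
  have dh0: "0 \<le> deriv h x" if "x \<in> ?E" for x
    by (rule mono_on_imp_deriv_nonneg[OF hmono_on dh[OF that]])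
      (use that open_E in \<open>simp add: interior_open\<close>)
  have hcont: "continuous_on ?E h"
    by (rule DERIV_continuous_on) (use dh in \<open>auto intro: has_field_derivative_at_within\<close>)
  have dK: "(cdf N has_real_derivative exp (h x) * deriv h x) (at x)" if x: "x \<in> ?E" for x
  proof (rule has_field_derivative_transform_within_open[OF _ open_E x])
    show "((\<lambda>x. exp (h x)) has_real_derivative exp (h x) * deriv h x) (at x)"
      by (rule DERIV_fun_exp[OF dh[OF x]])
    show "exp (h y) = cdf N y" if "y \<in> ?E" for y
      using assms(11)[OF that] Kpos[OF that] by (simp add: K)
  qed
  obtain u l :: "nat \<Rightarrow> real" where ul: "?E = (\<Union>i. {l i..u i})" "incseq u" "decseq l"
      "\<And>i. l i < u i" "\<And>i. 0 < ereal (l i)" "\<And>i. u i < s" "(\<lambda>i. ereal (l i)) \<longlonglongrightarrow> 0" "(\<lambda>i. ereal (u i)) \<longlonglongrightarrow> s"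
    by (blast intro: einterval_Icc_approximation[OF assms(2)])
  have l0: "0 < l i" for i using ul(5)[of i] by simp
  have l_lim: "l \<longlonglongrightarrow> 0" using ul(7) by (simp add: zero_ereal_def)
  have Icc: "{l i..u i} \<subseteq> ?E" for i unfolding ul(1) by auto
  have "AE x in lborel. x \<in> {l i<..u i} \<longrightarrow> k x = exp (h x) * deriv h x" for i
  proof (rule density_eq_deriv_cdf_AE[OF N.finite_borel_measure_M dens k assms(5)])
    show "continuous_on {l i..u i} (\<lambda>x. exp (h x) * deriv h x)"
      by (intro continuous_intros continuous_on_subset[OF hcont Icc]
          continuous_on_subset[OF assms(15) Icc])
  qed (use Icc[of i] ul(4)[of i] dK dh0 in \<open>auto simp: subset_eq\<close>)
  then have "AE x in lborel. \<forall>i. x \<in> {l i<..u i} \<longrightarrow> k x = exp (h x) * deriv h x"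
    by (subst AE_all_countable) blast
  then have k_eq: "AE x in lborel. x \<in> ?E \<longrightarrow> k x = exp (h x) * deriv h x"
  proof eventually_elim
    case (elim x)
    show ?case
    proof
      assume "x \<in> ?E"
      then have x: "0 < x" "ereal x < s" by (auto simp: einterval_iff zero_ereal_def)
      have "\<forall>\<^sub>F i in sequentially. l i < x \<and> ereal x < ereal (u i)"
        using order_tendstoD(2)[OF l_lim x(1)] order_tendstoD(1)[OF ul(8) x(2)]
        by (rule eventually_conj)
      from eventually_happens'[OF _ this] obtain i where "l i < x" "x < u i" by auto
      then show "k x = exp (h x) * deriv h x" using elim by auto
    qed
  qed
  \<comment> \<open>Working with \<open>c\<close> instead of \<open>\<psi> K\<close> gives continuity, hence measurability, of the integrands,
    although neither is known for \<open>\<psi>\<close>.\<close>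
  define c where "c x = deriv h x * f x" for x
  have c_cont: "continuous_on ?E c"
    unfolding c_def by (intro continuous_intros assms)
  have c0: "0 \<le> c x" if "x \<in> ?E" for x
    using dh0[OF that] assms(8)[OF that] assms(5)[of x] by (simp add: c_def assms(12)[OF that])
  have c_eq: "AE x in lborel. x \<in> ?E \<longrightarrow> c x * (- h x) powr \<gamma> = CPE_integrand \<psi> \<gamma> K x"
    using k_eq
  proof eventually_elim
    case (elim x)
    show ?case
    proof
      assume x: "x \<in> ?E"
      have "0 < k x" using x assms(6) by auto
      moreover have "exp (h x) = K x" using assms(11)[OF x] Kpos[OF x] by simp
      ultimately have "deriv h x = k x / K x" using elim x Kpos[OF x] by (simp add: field_simps)
      then have "c x = \<psi> x * K x"
        using \<open>0 < k x\<close> Kpos[OF x] by (simp add: c_def assms(12)[OF x] power2_eq_square)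
      then show "c x * (- h x) powr \<gamma> = CPE_integrand \<psi> \<gamma> K x"
        by (simp add: CPE_integrand_def assms(11)[OF x])
    qed
  qed
  have int_CPE: "set_integrable lborel ?E (CPE_integrand \<psi> \<gamma> K)"
    using assms(2,10) by (simp add: CPE_finite_def interval_lebesgue_integrable_def assms(7))
  have pw_cont: "continuous_on ?E (\<lambda>x. c x * (- h x) powr \<gamma>)"
    using hle assms(9) by (intro continuous_intros continuous_on_powr' c_cont hcont) auto
  have meas: "(\<lambda>x. indicat_real ?E x *\<^sub>R (c x * (- h x) powr \<gamma>)) \<in> borel_measurable lborel"
    using borel_measurable_continuous_on_indicator[OF _ pw_cont] by simp
  have meas': "(\<lambda>x. indicat_real ?E x *\<^sub>R CPE_integrand \<psi> \<gamma> K x) \<in> borel_measurable lborel"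
    using int_CPE by (auto simp: set_integrable_def)
  have ae: "AE x in lborel. indicat_real ?E x *\<^sub>R (c x * (- h x) powr \<gamma>)
      = indicat_real ?E x *\<^sub>R CPE_integrand \<psi> \<gamma> K x"
    using c_eq by eventually_elim (auto simp: indicator_def)
  have int_c: "set_integrable lborel ?E (\<lambda>x. c x * (- h x) powr \<gamma>)"
    using int_CPE integrable_cong_AE[OF meas meas' ae] by (simp add: set_integrable_def)
  have CPE_eq: "CPE M X s \<psi> \<gamma> =
      1 / Gamma (\<gamma> + 1) * (LBINT x:?E. c x * (- h x) powr \<gamma>)"
    using integral_cong_AE[OF meas meas' ae] assms(2)
    by (simp add: CPE_def interval_lebesgue_integral_def set_lebesgue_integral_def assms(7))
  have supp: "AE x in N. ereal x < s"
  proof -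
    have "AE x in density lborel (\<lambda>x. ennreal (k x)). ereal x < s"
      using k assms(6) by (subst AE_density) (auto simp: einterval_iff set_eq_iff)
    then show ?thesis by (simp only: dens)
  qed
  have h_lim: "((\<lambda>t. h (real_of_ereal t)) \<longlongrightarrow> 0) (at_left s)"
  proof (rule Lim_transform_eventually)
    show "((\<lambda>t. ln (K (real_of_ereal t))) \<longlongrightarrow> 0) (at_left s)"
      using tendsto_ln[OF cdf_tendsto_1_at_left_sup[OF N supp assms(2)]] by (simp add: K)
    have "\<forall>\<^sub>F t in at_left s. 0 < t \<and> t < s"
      using eventually_at_left[of 0 s] assms(2) by auto
    then show "\<forall>\<^sub>F t in at_left s. ln (K (real_of_ereal t)) = h (real_of_ereal t)"
    proof eventually_elim
      case (elim t)
      then have "real_of_ereal t \<in> ?E" by (cases t) (auto simp: einterval_iff)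
      then show ?case using assms(11) by simp
    qed
  qed
  \<comment> \<open>The kernel exponent is \<open>1 - (\<gamma> + 1) = - \<gamma>\<close>; at the zero of the kernel both sides are \<open>0\<close>.\<close>
  have RL: "RL_integral (\<gamma> + 1) h f a (real_of_ereal t) = 1 / Gamma (\<gamma> + 1) *
      (LBINT x=ereal a..ereal (real_of_ereal t). c x * (h (real_of_ereal t) - h x) powr \<gamma>)" for a t
    by (simp add: RL_integral_def c_def powr_minus divide_inverse)
  show ?thesis
    unfolding RL CPE_eq
    using tendsto_mult_left[OF truncated_kernel_tendsto[OF assms(2,9) c_cont c0 hcont hmono_on hle
        h_lim int_c], of "1 / Gamma (\<gamma> + 1)"]
    by (simp add: case_prod_unfold)
qed

end
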